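(* Let $u_h(x,t^n)\in V_h^k$ be a DG solution for $u_t+(a(x,t)u)_x=0$ on $[x_a,x_b]$ with periodic boundary conditions, and let $u_h(\cdot,t^{n+1})\in V_h^k$ be obtained from it by one step of the fully discrete GEL DG scheme with SSP Runge-Kutta time discretization. Then the scheme is locally mass conservative (the cell masses are updated through numerical fluxes that are single-valued at cell interfaces). In particular, $$\sum_{j=1}^N\int_{I_j}u_h(x,t^{n+1})\,dx=\sum_{j=1}^N\int_{I_j}u_h(x,t^n)\,dx .$$
   Context: Mesh: $x_a=x_{1/2}<\dots<x_{N+1/2}=x_b$, $I_j=[x_{j-1/2},x_{j+1/2}]$, $x_j$ is the midpoint of $I_j$, $V_h^k=\{v: v|_{I_j}\in P^k(I_j)\ \forall j\}$, $\Delta t=t^{n+1}-t^n$. The velocity $a$ is continuous; all data and indices are periodic. Space-time partition: $\tilde x_{j+1/2}(t)=x_{j+1/2}+(t-t^{n+1})\nu_{j+1/2}$ with $\nu_{j+1/2}=a(x_{j+1/2},t^{n+1})$; $\tilde I_j(t)=[\tilde x_{j-1/2}(t),\tilde x_{j+1/2}(t)]$, assumed to have positive length for $t\in[t^n,t^{n+1}]$; the upstream cell is $I_j^\star=\tilde I_j(t^n)$. Test and basis functions: let $\alpha_j=a(x_j,t^{n+1})$ and let $\{\Psi_{j,m}\}_{m=0}^k$ be a basis of the polynomials of degree at most $k$. Test functions: $\psi_{j,m}(x,t)=\Psi_{j,m}(x-\alpha_j(t-t^{n+1}))$. Basis functions: $\tilde\psi_{j,m}(x,t)=\Psi_{j,m}(\xi)$,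 where $\xi\in I_j$ corresponds to $x\in\tilde I_j(t)$ under the increasing affine map $I_j\to\tilde I_j(t)$. Write $u_h(x,t)=\sum_{l=0}^k\hat u_j^{(l)}(t)\tilde\psi_{j,l}(x,t)$ on $\tilde I_j(t)$, $U_j=(\hat u_j^{(0)},\dots,\hat u_j^{(k)})^T$, and let $A_j(t)$ be the matrix with $(m,l)$ entry $\int_{\tilde I_j(t)}\tilde\psi_{j,l}\psi_{j,m}\,dx$, so that $A_j(t)U_j$ has entries $\int_{\tilde I_j(t)}u_h\psi_{j,m}\,dx$. Spatial operator: $\mathcal L(U_{j-1},U_j,U_{j+1},t)$ is the vector with $m$-th entry $$-\hat F_{j+1/2}\,\psi_{j,m}(\tilde x_{j+1/2}(t),t)+\hat F_{j-1/2}\,\psi_{j,m}(\tilde x_{j-1/2}(t),t)+\int_{\tilde I_j(t)}(a-\alpha_j)u_h\,\partial_x\psi_{j,m}\,dx,$$ where the integral is evaluated by the $(k+1)$-point Gauss rule and $\hat F_{j+1/2}=\hat F(u_h^-,u_h^+)$ is a monotone numerical flux (e.g. Lax-Friedrichs), consistent with $F(u)=(a(\tilde x_{j+1/2}(t),t)-\nu_{j+1/2})u$, evaluated at the one-sided limits of $u_h$ at $\tilde x_{j+1/2}(t)$. Fully discrete scheme: (i) $U_j^{(0)}$ is determined by $A_j(t^n)U_j^{(0)}=\big(\int_{I_j^\star}u_h(x,t^n)\psi_{j,m}(x,t^n)\,dx\big)_{m=0}^k$, where $u_h(\cdot,t^n)\in V_h^k$ is extended periodically (this is the $L^2$ projection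 onto the upstream cell). (ii) For stages $i=1,\dots,s$, $$A_j(t^{(i)})U_j^{(i)}=\sum_{l=0}^{i-1}\Big[\alpha_{il}A_j(t^{(l)})U_j^{(l)}+\beta_{il}\Delta t\,\mathcal L(U_{j-1}^{(l)},U_j^{(l)},U_{j+1}^{(l)},t^{(l)})\Big],$$ where $t^{(l)}=t^n+d_l\Delta t$, $t^{(0)}=t^n$, $t^{(s)}=t^{n+1}$, and $\alpha_{il},\beta_{il}$ are the coefficients of the Runge-Kutta method, with $\sum_l\alpha_{il}=1$. Then $u_h(\cdot,t^{n+1})$ on $I_j$ is given by the coefficients $U_j^{(s)}$. Locally mass conservative means that there are numbers $\hat H_{j+1/2}$, one per interface, with $\int_{I_j}u_h(x,t^{n+1})\,dx=\int_{I_j^\star}u_h(x,t^n)\,dx-\Delta t(\hat H_{j+1/2}-\hat H_{j-1/2})$ for all $j$. *)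

theory Defs
  imports "HOL-Analysis.Analysis" "HOL-Computational_Algebra.Polynomial"
begin

text \<open>
  Cells and interfaces are indexed by the integers and everything is extended periodically with
  period \<open>ncells\<close>.  Interface \<open>j\<close> stands for the half-integer index \<open>j + 1/2\<close>, so
  \<open>iface D j\<close> is $x_{j+1/2}$, cell \<open>j\<close> lies between the interfaces \<open>j - 1\<close> and \<open>j\<close>, and
  $x_a$, $x_b$ are \<open>iface D 0\<close> and \<open>iface D (int (ncells D))\<close>.
\<close>

record gel_dg =
  ncells :: nat
  pdeg :: nat
  iface :: "int \<Rightarrow> real"
  vel :: "real \<Rightarrow> real \<Rightarrow> real"  \<comment> \<open>\<open>vel D x t\<close> is $a(x,t)$\<close>
  told :: real  \<comment> \<open>$t^n$\<close>
  tnew :: real  \<comment> \<open>$t^{n+1}$\<close>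
  basis_poly :: "int \<Rightarrow> nat \<Rightarrow> real poly"  \<comment> \<open>$\Psi_{j,m}$, used for $m \le k$\<close>
  nflux :: "int \<Rightarrow> real \<Rightarrow> real \<Rightarrow> real \<Rightarrow> real"
    \<comment> \<open>\<open>nflux D j t u\<^sub>- u\<^sub>+\<close>: $\hat F$ at interface \<open>j\<close> and time \<open>t\<close>; it depends on
      \<open>j\<close> and \<open>t\<close> because the flux $F$ it is consistent with does\<close>
  gnode :: "nat \<Rightarrow> real"  \<comment> \<open>quadrature nodes on $[-1,1]$\<close>
  gweight :: "nat \<Rightarrow> real"
  nstages :: nat
  rk_alpha :: "nat \<Rightarrow> nat \<Rightarrow> real"
  rk_beta :: "nat \<Rightarrow> nat \<Rightarrow> real"
  rk_d :: "nat \<Rightarrow> real"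

definition period :: "gel_dg \<Rightarrow> real" where
  "period D = iface D (int (ncells D)) - iface D 0"

definition cell :: "gel_dg \<Rightarrow> int \<Rightarrow> real set" where
  "cell D j = {iface D (j - 1)..iface D j}"

definition midpt :: "gel_dg \<Rightarrow> int \<Rightarrow> real" where
  "midpt D j = (iface D (j - 1) + iface D j) / 2"

definition dt :: "gel_dg \<Rightarrow> real" where
  "dt D = tnew D - told D"

definition nu :: "gel_dg \<Rightarrow> int \<Rightarrow> real" where
  "nu D j = vel D (iface D j) (tnew D)"

definition moving_iface :: "gel_dg \<Rightarrow> int \<Rightarrow> real \<Rightarrow> real" where
  "moving_iface D j t = iface D j + (t - tnew D) * nu D j"

definition moving_cell :: "gel_dg \<Rightarrow> int \<Rightarrow> real \<Rightarrow> real set" where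
  "moving_cell D j t = {moving_iface D (j - 1) t..moving_iface D j t}"

definition upstream_cell :: "gel_dg \<Rightarrow> int \<Rightarrow> real set" where
  "upstream_cell D j = moving_cell D j (told D)"

definition cell_vel :: "gel_dg \<Rightarrow> int \<Rightarrow> real" where
  "cell_vel D j = vel D (midpt D j) (tnew D)"

text \<open>
  The broken polynomial space $V_h^k$, extended periodically.  Its elements are double-valued at the
  interfaces, so only the values inside the cells are prescribed.
\<close>

definition Vh :: "gel_dg \<Rightarrow> (real \<Rightarrow> real) set" where
  "Vh D = {v. (\<forall>x. v (x + period D) = v x) \<and>
              (\<forall>j. \<exists>p. degree p \<le> pdeg D \<and> (\<forall>x\<in>interior (cell D j). v x = poly p x))}"

definition test_fun :: "gel_dg \<Rightarrow> int \<Rightarrow> nat \<Rightarrow> real \<Rightarrow> real \<Rightarrow> real" where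
  "test_fun D j m x t = poly (basis_poly D j m) (x - cell_vel D j * (t - tnew D))"

text \<open>The point $\xi$ of the cell $I_j$ that corresponds to the point $x$ of the moving cell.\<close>

definition ref_pt :: "gel_dg \<Rightarrow> int \<Rightarrow> real \<Rightarrow> real \<Rightarrow> real" where
  "ref_pt D j x t = iface D (j - 1) +
     (x - moving_iface D (j - 1) t) * (iface D j - iface D (j - 1)) /
     (moving_iface D j t - moving_iface D (j - 1) t)"

definition basis_fun :: "gel_dg \<Rightarrow> int \<Rightarrow> nat \<Rightarrow> real \<Rightarrow> real \<Rightarrow> real" where
  "basis_fun D j m x t = poly (basis_poly D j m) (ref_pt D j x t)"

text \<open>
  \<open>U j l\<close> is the coefficient $\hat u_j^{(l)}$, and \<open>uh D U j t\<close> is the restriction of $u_h(\cdot,t)$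
  to the moving cell \<open>j\<close>.
\<close>

definition uh :: "gel_dg \<Rightarrow> (int \<Rightarrow> nat \<Rightarrow> real) \<Rightarrow> int \<Rightarrow> real \<Rightarrow> real \<Rightarrow> real" where
  "uh D U j t x = (\<Sum>l\<le>pdeg D. U j l * basis_fun D j l x t)"

definition mass_matrix :: "gel_dg \<Rightarrow> int \<Rightarrow> real \<Rightarrow> nat \<Rightarrow> nat \<Rightarrow> real" where
  "mass_matrix D j t m l =
     integral (moving_cell D j t) (\<lambda>x. basis_fun D j l x t * test_fun D j m x t)"

definition mass_mult :: "gel_dg \<Rightarrow> int \<Rightarrow> real \<Rightarrow> (nat \<Rightarrow> real) \<Rightarrow> nat \<Rightarrow> real" where
  "mass_mult D j t c m = (\<Sum>l\<le>pdeg D. mass_matrix D j t m l * c l)"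

definition trace_left :: "gel_dg \<Rightarrow> (int \<Rightarrow> nat \<Rightarrow> real) \<Rightarrow> int \<Rightarrow> real \<Rightarrow> real" where
  "trace_left D U j t = Lim (at_left (moving_iface D j t)) (uh D U j t)"

definition trace_right :: "gel_dg \<Rightarrow> (int \<Rightarrow> nat \<Rightarrow> real) \<Rightarrow> int \<Rightarrow> real \<Rightarrow> real" where
  "trace_right D U j t = Lim (at_right (moving_iface D j t)) (uh D U (j + 1) t)"

definition iface_flux :: "gel_dg \<Rightarrow> (int \<Rightarrow> nat \<Rightarrow> real) \<Rightarrow> int \<Rightarrow> real \<Rightarrow> real" where
  "iface_flux D U j t = nflux D j t (trace_left D U j t) (trace_right D U j t)"

text \<open>
  The \<open>q\<close>-point Gauss rule on $[-1,1]$ is the \<open>q\<close>-point rule that is exact for polynomials of degree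
  at most $2q - 1$; this determines it up to the numbering of the nodes.
\<close>

definition is_gauss_rule :: "nat \<Rightarrow> (nat \<Rightarrow> real) \<Rightarrow> (nat \<Rightarrow> real) \<Rightarrow> bool" where
  "is_gauss_rule q g w \<longleftrightarrow>
     inj_on g {..<q} \<and> g ` {..<q} \<subseteq> {-1..1} \<and>
     (\<forall>p. degree p \<le> 2 * q - 1 \<longrightarrow>
        (\<Sum>i<q. w i * poly p (g i)) = integral {-1..1} (poly p))"

definition gauss_quad :: "gel_dg \<Rightarrow> real \<Rightarrow> real \<Rightarrow> (real \<Rightarrow> real) \<Rightarrow> real" where
  "gauss_quad D c d f =
     (d - c) / 2 * (\<Sum>i<pdeg D + 1. gweight D i * f ((c + d) / 2 + (d - c) / 2 * gnode D i))"

definition spatial_op :: "gel_dg \<Rightarrow> (int \<Rightarrow> nat \<Rightarrow> real) \<Rightarrow> int \<Rightarrow> real \<Rightarrow> nat \<Rightarrow> real" where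
  "spatial_op D U j t m =
     - iface_flux D U j t * test_fun D j m (moving_iface D j t) t
     + iface_flux D U (j - 1) t * test_fun D j m (moving_iface D (j - 1) t) t
     + gauss_quad D (moving_iface D (j - 1) t) (moving_iface D j t)
         (\<lambda>x. (vel D x t - cell_vel D j) * uh D U j t x * deriv (\<lambda>y. test_fun D j m y t) x)"

definition stage_time :: "gel_dg \<Rightarrow> nat \<Rightarrow> real" where
  "stage_time D l = told D + rk_d D l * dt D"

definition mesh_ok :: "gel_dg \<Rightarrow> bool" where
  "mesh_ok D \<longleftrightarrow>
     ncells D \<ge> 1 \<and> told D < tnew D \<and> strict_mono (iface D) \<and>
     (\<forall>j. iface D (j + int (ncells D)) = iface D j + period D) \<and>
     (\<forall>j. \<forall>t\<in>{told D..tnew D}. moving_iface D (j - 1) t < moving_iface D j t)"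

definition vel_ok :: "gel_dg \<Rightarrow> bool" where
  "vel_ok D \<longleftrightarrow>
     continuous_on UNIV (\<lambda>(x, t). vel D x t) \<and>
     (\<forall>x t. vel D (x + period D) t = vel D x t)"

definition basis_ok :: "gel_dg \<Rightarrow> bool" where
  "basis_ok D \<longleftrightarrow>
     (\<forall>j. inj_on (basis_poly D j) {..pdeg D} \<and>
          \<not> module.dependent smult (basis_poly D j ` {..pdeg D}) \<and>
          module.span smult (basis_poly D j ` {..pdeg D}) = {p. degree p \<le> pdeg D}) \<and>
     (\<forall>j. \<forall>m\<le>pdeg D. \<forall>x.
          poly (basis_poly D (j + int (ncells D)) m) (x + period D) = poly (basis_poly D j m) x)"

definition flux_ok :: "gel_dg \<Rightarrow> bool" where
  "flux_ok D \<longleftrightarrow>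
     (\<forall>j t w. mono (\<lambda>u. nflux D j t u w) \<and> antimono (\<lambda>u. nflux D j t w u)) \<and>
     (\<forall>j t u. nflux D j t u u = (vel D (moving_iface D j t) t - nu D j) * u) \<and>
     (\<forall>j t. nflux D (j + int (ncells D)) t = nflux D j t)"

text \<open>
  Shu-Osher form of a strong stability preserving method: every stage is a convex combination of
  forward Euler steps with step sizes $\beta_{il} \Delta t / \alpha_{il}$.
\<close>

definition ssp_rk_ok :: "gel_dg \<Rightarrow> bool" where
  "ssp_rk_ok D \<longleftrightarrow>
     nstages D \<ge> 1 \<and> rk_d D 0 = 0 \<and> rk_d D (nstages D) = 1 \<and>
     (\<forall>i\<in>{1..nstages D}.
        (\<Sum>l<i. rk_alpha D i l) = 1 \<and>
        (\<forall>l<i. rk_alpha D i l \<ge> 0 \<and> rk_beta D i l \<ge> 0 \<and>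
               (rk_alpha D i l = 0 \<longrightarrow> rk_beta D i l = 0)))"

text \<open>
  \<open>U i j l\<close> is the coefficient number \<open>l\<close> in cell \<open>j\<close> at stage \<open>i\<close>; \<open>v\<close> and \<open>v'\<close> are
  $u_h(\cdot,t^n)$ and $u_h(\cdot,t^{n+1})$.
\<close>

definition gel_dg_step :: "gel_dg \<Rightarrow> (real \<Rightarrow> real) \<Rightarrow> (real \<Rightarrow> real) \<Rightarrow> bool" where
  "gel_dg_step D v v' \<longleftrightarrow>
     (\<exists>U :: nat \<Rightarrow> int \<Rightarrow> nat \<Rightarrow> real.
        (\<forall>i\<le>nstages D. \<forall>j. \<forall>l\<le>pdeg D. U i (j + int (ncells D)) l = U i j l) \<and>
        (\<forall>j. \<forall>m\<le>pdeg D.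
           mass_mult D j (told D) (U 0 j) m =
             integral (upstream_cell D j) (\<lambda>x. v x * test_fun D j m x (told D))) \<and>
        (\<forall>i\<in>{1..nstages D}. \<forall>j. \<forall>m\<le>pdeg D.
           mass_mult D j (stage_time D i) (U i j) m =
             (\<Sum>l<i. rk_alpha D i l * mass_mult D j (stage_time D l) (U l j) m
                    + rk_beta D i l * dt D * spatial_op D (U l) j (stage_time D l) m)) \<and>
        (\<forall>j. \<forall>x\<in>interior (cell D j). v' x = uh D (U (nstages D)) j (tnew D) x))"

text \<open>
  The numbers \<open>H j\<close> are periodic since the interfaces at $x_a$ and $x_b$ are identified.
\<close>

definition locally_mass_conservative :: "gel_dg \<Rightarrow> (real \<Rightarrow> real) \<Rightarrow> (real \<Rightarrow> real) \<Rightarrow> bool" where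
  "locally_mass_conservative D v v' \<longleftrightarrow>
     (\<exists>H :: int \<Rightarrow> real.
        (\<forall>j. H (j + int (ncells D)) = H j) \<and>
        (\<forall>j. integral (cell D j) v' =
               integral (upstream_cell D j) v - dt D * (H j - H (j - 1))))"

end

theory Submission
  imports Defs
begin

text \<open>
  The constant 1 lies in the span of the test functions of every cell.  Testing the scheme with it
  kills the volume term of the spatial operator, so every stage updates the cell masses by
  differences of interface fluxes; unrolling the stages, the numbers
  $H^{(i)} = \sum_{l<i} (\alpha_{il} H^{(l)} + \beta_{il} \hat F^{(l)})$ are single-valued
  interface fluxes, and $H^{(s)}$ is the one required.  Summing over the cells, the fluxes telescope,
  and the upstream cells tile a translate of the period.
\<close>

subsection \<open>Integrals of periodic functions\<close>

lemma integral_shift_periodic: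
  fixes f :: "real \<Rightarrow> real"
  assumes "\<And>x. f (x + p) = f x"
  shows "integral {a + p..b + p} f = integral {a..b} f"
  using integral_shift_Icc_real[of a b f p] assms by (simp add: comp_def add.commute)

text \<open>Cut \<open>{a..b + p}\<close> once at \<open>b\<close> and once at \<open>a + p\<close>;
  the pieces \<open>{a..b}\<close> and \<open>{a + p..b + p}\<close> have equal integrals by
  periodicity, so the other two pieces agree as well.\<close>

lemma integral_over_period:
  fixes f :: "real \<Rightarrow> real"
  assumes per: "\<And>x. f (x + p) = f x" and "0 \<le> p"
    and int: "\<And>a b. f integrable_on {a..b}"
  shows "integral {a..a + p} f = integral {b..b + p} f"
proof -
  \<comment> \<open>The claim is symmetric in \<open>a\<close> and \<open>b\<close>, so one order
    suffices. No order between \<open>b\<close> and \<open>a + p\<close> is required.\<close>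
  have *: "integral {a..a + p} f = integral {b..b + p} f" if "a \<le> b" for a b
  proof -
    have "integral {a..b} f + integral {b..b + p} f = integral {a..b + p} f"
      using that \<open>0 \<le> p\<close> int by (intro Henstock_Kurzweil_Integration.integral_combine) auto
    moreover have "integral {a..a + p} f + integral {a + p..b + p} f = integral {a..b + p} f"
      using that \<open>0 \<le> p\<close> int by (intro Henstock_Kurzweil_Integration.integral_combine) auto
    ultimately show ?thesis
      using integral_shift_periodic[of f p a b] per by simp
  qed
  show ?thesis
    using *[of a b] *[of b a] by linarith
qed

text \<open>Stated for arbitrary nodes \<open>z\<close> so that it serves both the fixed mesh and
  the interfaces traced back to the old time.\<close>

lemma sum_integral_consecutive:
  fixes f :: "real \<Rightarrow> real" and z :: "int \<Rightarrow> real"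
  assumes le: "\<And>j. z (j - 1) \<le> z j" and int: "\<And>a b. f integrable_on {a..b}"
  shows "(\<Sum>j=1..int n. integral {z (j - 1)..z j} f) = integral {z 0..z (int n)} f"
proof (induction n)
  case (Suc n)
  have mono: "z 0 \<le> z (int n)" for n
    using le[of "1 + int _"] by (induction n) (auto intro: order_trans)
  have "{1..int (Suc n)} = insert (1 + int n) {1..int n}"
    by auto
  then have "(\<Sum>j=1..int (Suc n). integral {z (j - 1)..z j} f) =
      integral {z 0..z (int n)} f + integral {z (int n)..z (1 + int n)} f"
    using Suc by simp
  also have "\<dots> = integral {z 0..z (1 + int n)} f"
    using mono[of n] le[of "1 + int n"] int
    by (intro Henstock_Kurzweil_Integration.integral_combine) auto
  finally show ?case
    by simp
qed simp

subsection \<open>The broken polynomial space\<close>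

text \<open>The values of \<open>v\<close> at the two interfaces are arbitrary, but these points
  form a negligible set; elsewhere in the cell the product is continuous.\<close>

lemma Vh_mult_continuous_integrable_cell:
  assumes "v \<in> Vh D" and g: "continuous_on UNIV g"
  shows "(\<lambda>x. v x * g x) integrable_on cell D j"
proof -
  obtain p where p: "\<And>x. x \<in> interior (cell D j) \<Longrightarrow> v x = poly p x"
    using assms unfolding Vh_def by blast
  show ?thesis
  proof (rule integrable_spike)
    show "(\<lambda>x. poly p x * g x) integrable_on cell D j"
      unfolding cell_def
      by (intro integrable_continuous_interval continuous_intros continuous_on_subset[OF g]) auto
    show "negligible {iface D (j - 1), iface D j}"
      by simp
    show "v x * g x = poly p x * g x" if "x \<in> cell D j - {iface D (j - 1), iface D j}" for x
      using that by (subst p) (auto simp: cell_def)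
  qed
qed

lemma period_pos: "mesh_ok D \<Longrightarrow> 0 < period D"
  unfolding mesh_ok_def period_def by (auto simp: strict_mono_def)

lemma iface_shift_multiple:
  assumes "mesh_ok D"
  shows "iface D (j + int n * int (ncells D)) = iface D j + real n * period D"
proof (induction n)
  case (Suc n)
  have "iface D (j + int (Suc n) * int (ncells D)) =
      iface D ((j + int n * int (ncells D)) + int (ncells D))"
    by (simp add: algebra_simps)
  also have "\<dots> = iface D (j + int n * int (ncells D)) + period D"
    using assms unfolding mesh_ok_def by blast
  finally show ?case
    using Suc by (simp add: algebra_simps)
qed simp

text \<open>Upstream cells may cut across mesh cells, so integrability is needed on arbitrary
  intervals. Every interval lies between two interfaces, and finitely many cells are glued
  there.\<close>

lemma Vh_mult_continuous_integrable:
  assumes mesh: "mesh_ok D" and v: "v \<in> Vh D" and g: "continuous_on UNIV g"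
  shows "(\<lambda>x. v x * g x) integrable_on {a..b}"
proof -
  have mono: "i \<le> j \<Longrightarrow> iface D i \<le> iface D j" for i j
    using mesh unfolding mesh_ok_def by (simp add: strict_mono_less_eq)
  have ifaces: "(\<lambda>x. v x * g x) integrable_on {iface D i..iface D (i + int n)}" for i n
  proof (induction n)
    case (Suc n)
    have "(\<lambda>x. v x * g x) integrable_on {iface D (i + int n)..iface D (i + int (Suc n))}"
      using Vh_mult_continuous_integrable_cell[OF v g, of "i + int (Suc n)"]
      by (simp add: cell_def add.assoc)
    then show ?case
      by (rule Henstock_Kurzweil_Integration.integrable_combine[OF _ _ Suc, rotated 2])
        (auto intro: mono)
  qed (simp add: integrable_on_refl[of _ "iface D i", simplified])
  obtain m where m: "iface D 0 - a < real m * period D"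
    using reals_Archimedean3[OF period_pos[OF mesh]] by blast
  obtain n where n: "b - iface D 0 < real n * period D"
    using reals_Archimedean3[OF period_pos[OF mesh]] by blast
  \<comment> \<open>Interface \<open>i\<close> lies \<open>m\<close> periods to the left of
    interface 0, hence left of \<open>a\<close>; going \<open>(m + n) * ncells D\<close> interfaces
    further leads \<open>n\<close> periods to the right of interface 0, hence beyond
    \<open>b\<close>.\<close>
  define i where "i = - int m * int (ncells D)"
  have "iface D (i + int m * int (ncells D)) = iface D i + real m * period D"
    by (rule iface_shift_multiple[OF mesh])
  then have "iface D i \<le> a"
    using m by (simp add: i_def)
  moreover have "b \<le> iface D (i + int ((m + n) * ncells D))"
    using n iface_shift_multiple[OF mesh, of 0 n] by (simp add: i_def algebra_simps)
  ultimately show ?thesis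
    by (intro integrable_subinterval_real[OF ifaces[of i "(m + n) * ncells D"]]) auto
qed

subsection \<open>Periodicity of the interface fluxes\<close>

lemma moving_iface_shift:
  assumes "mesh_ok D" "vel_ok D"
  shows "moving_iface D (j + int (ncells D)) t = moving_iface D j t + period D"
  using assms unfolding moving_iface_def nu_def mesh_ok_def vel_ok_def by simp

lemma ref_pt_shift:
  assumes "mesh_ok D" "vel_ok D"
  shows "ref_pt D (j + int (ncells D)) (x + period D) t = ref_pt D j x t + period D"
proof -
  have [simp]: "iface D (j + int (ncells D)) = iface D j + period D" for j
    using assms unfolding mesh_ok_def by blast
  have [simp]: "j + int (ncells D) - 1 = j - 1 + int (ncells D)"
    by simp
  show ?thesis
    unfolding ref_pt_def by (simp add: moving_iface_shift[OF assms] del: diff_add_eq)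
qed

lemma uh_shift:
  assumes "mesh_ok D" "vel_ok D" "basis_ok D"
    and "\<And>l. l \<le> pdeg D \<Longrightarrow> U (j + int (ncells D)) l = U j l"
  shows "uh D U (j + int (ncells D)) t (x + period D) = uh D U j t x"
  unfolding uh_def
proof (rule sum.cong)
  fix l assume "l \<in> {..pdeg D}"
  then show "U (j + int (ncells D)) l * basis_fun D (j + int (ncells D)) l (x + period D) t =
      U j l * basis_fun D j l x t"
    using assms(3,4) unfolding basis_fun_def basis_ok_def by (simp add: ref_pt_shift[OF assms(1,2)])
qed simp

section \<open>Continuity in space and one-sided traces\<close>

lemma continuous_on_ref_pt: "continuous_on S (\<lambda>x. ref_pt D j x t)"
  \<comment> \<open>The denominator is constant in \<open>x\<close>; as multiplication by a constant
    the quotient is continuous for every \<open>t\<close>, even where that denominator is 0.\<close>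
  unfolding ref_pt_def divide_inverse by (intro continuous_intros)

lemma continuous_on_basis_fun: "continuous_on S (\<lambda>x. basis_fun D j l x t)"
  unfolding basis_fun_def by (intro continuous_intros continuous_on_ref_pt)

lemma continuous_on_test_fun: "continuous_on S (\<lambda>x. test_fun D j m x t)"
  unfolding test_fun_def by (intro continuous_intros)

lemma continuous_on_uh: "continuous_on S (uh D U j t)"
  unfolding uh_def by (intro continuous_intros continuous_on_basis_fun)

lemma isCont_uh: "isCont (uh D U j t) x"
  using continuous_on_uh[of UNIV] by (simp add: continuous_on_eq_continuous_at)

text \<open>For a fixed cell, \<open>uh\<close> is a polynomial expression in \<open>x\<close> on
  the whole line, so its one-sided limit at an interface is its value there.\<close>

lemma trace_left_eq: "trace_left D U j t = uh D U j t (moving_iface D j t)"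
  unfolding trace_left_def
  by (intro tendsto_Lim trivial_limit_at_left_real
      tendsto_within_subset[OF isCont_uh[unfolded isCont_def]]) auto

lemma trace_right_eq: "trace_right D U j t = uh D U (j + 1) t (moving_iface D j t)"
  unfolding trace_right_def
  by (intro tendsto_Lim trivial_limit_at_right_real
      tendsto_within_subset[OF isCont_uh[unfolded isCont_def]]) auto

lemma iface_flux_shift:
  assumes "mesh_ok D" "vel_ok D" "basis_ok D" "flux_ok D"
    and U: "\<And>j l. l \<le> pdeg D \<Longrightarrow> U (j + int (ncells D)) l = U j l"
  shows "iface_flux D U (j + int (ncells D)) t = iface_flux D U j t"
proof -
  have shift: "uh D U (j + int (ncells D)) t (x + period D) = uh D U j t x" for j x
    using assms(1-3) U by (rule uh_shift)
  \<comment> \<open>The right trace at interface \<open>j\<close> is taken from cell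
    \<open>j + 1\<close>.\<close>
  have "uh D U (j + int (ncells D) + 1) t (x + period D) = uh D U (j + 1) t x" for x
    using shift[of "j + 1"] by (simp add: ac_simps)
  then show ?thesis
    using assms(4) shift unfolding iface_flux_def flux_ok_def
    by (simp add: trace_left_eq trace_right_eq moving_iface_shift[OF assms(1,2)])
qed

subsection \<open>Testing with the constant function\<close>

text \<open>The constant 1 has degree 0, so it is in the span; injectivity of the numbering turns
  the sum over the set of basis polynomials into a sum over indices.\<close>

lemma basis_poly_combine_1:
  assumes "basis_ok D"
  obtains c where "(\<Sum>m\<le>pdeg D. smult (c m) (basis_poly D j m)) = 1"
proof -
  interpret module "smult :: real \<Rightarrow> real poly \<Rightarrow> real poly"
    by unfold_locales (auto simp: smult_add_left smult_add_right)
  have "inj_on (basis_poly D j) {..pdeg D}"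
    and span: "span (basis_poly D j ` {..pdeg D}) = {p. degree p \<le> pdeg D}"
    using assms unfolding basis_ok_def by blast+
  have "1 \<in> span (basis_poly D j ` {..pdeg D})"
    unfolding span by simp
  then obtain u where "1 = (\<Sum>p\<in>basis_poly D j ` {..pdeg D}. smult (u p) p)"
    by (auto simp: span_finite)
  also have "\<dots> = (\<Sum>m\<le>pdeg D. smult (u (basis_poly D j m)) (basis_poly D j m))"
    by (simp add: sum.reindex \<open>inj_on _ _\<close>)
  finally show thesis
    using that[of "\<lambda>m. u (basis_poly D j m)"] by simp
qed

text \<open>All test functions of a cell evaluate their basis polynomials at the same shifted point.
  Hence the coefficients \<open>c\<close> depend on neither \<open>x\<close> nor \<open>t\<close>,
  and one choice works at all stage times.\<close>

lemma test_fun_combine_1: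
  assumes "(\<Sum>m\<le>pdeg D. smult (c m) (basis_poly D j m)) = 1"
  shows "(\<Sum>m\<le>pdeg D. c m * test_fun D j m x t) = 1"
  using arg_cong[OF assms, of "\<lambda>p. poly p (x - cell_vel D j * (t - tnew D))"]
  by (simp add: test_fun_def poly_sum)

lemma integral_combine_test_fun:
  assumes c: "\<And>x. (\<Sum>m\<le>pdeg D. c m * test_fun D j m x t) = 1"
    and "\<And>m. (\<lambda>x. f x * test_fun D j m x t) integrable_on S"
  shows "(\<Sum>m\<le>pdeg D. c m * integral S (\<lambda>x. f x * test_fun D j m x t)) = integral S f"
proof -
  have "(\<Sum>m\<le>pdeg D. c m * integral S (\<lambda>x. f x * test_fun D j m x t)) =
      integral S (\<lambda>x. \<Sum>m\<le>pdeg D. c m * (f x * test_fun D j m x t))"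
    using assms(2) by (subst integral_sum) (auto intro: integrable_on_mult_right)
  also have "\<dots> = integral S (\<lambda>x. f x * (\<Sum>m\<le>pdeg D. c m * test_fun D j m x t))"
    by (simp add: sum_distrib_left mult.left_commute)
  finally show ?thesis
    by (simp add: c)
qed

lemma mass_mult_eq_integral:
  "mass_mult D j t (U j) m = integral (moving_cell D j t) (\<lambda>x. uh D U j t x * test_fun D j m x t)"
proof -
  have "(\<lambda>x. basis_fun D j l x t * test_fun D j m x t) integrable_on moving_cell D j t" for l
    unfolding moving_cell_def
    by (intro integrable_continuous_interval continuous_intros continuous_on_basis_fun
        continuous_on_test_fun)
  then have "integral (moving_cell D j t)
      (\<lambda>x. \<Sum>l\<le>pdeg D. U j l * (basis_fun D j l x t * test_fun D j m x t)) =
      (\<Sum>l\<le>pdeg D. U j l * mass_matrix D j t m l)"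
    unfolding mass_matrix_def by (subst integral_sum) (auto intro: integrable_on_mult_right)
  then show ?thesis
    unfolding mass_mult_def uh_def sum_distrib_right mult.assoc by (simp add: mult.commute)
qed

lemma mass_mult_combine:
  assumes "\<And>x. (\<Sum>m\<le>pdeg D. c m * test_fun D j m x t) = 1"
  shows "(\<Sum>m\<le>pdeg D. c m * mass_mult D j t (U j) m) = integral (moving_cell D j t) (uh D U j t)"
  unfolding mass_mult_eq_integral using assms
  by (rule integral_combine_test_fun) (unfold moving_cell_def,
      intro integrable_continuous_interval continuous_intros continuous_on_uh continuous_on_test_fun)

lemma test_fun_has_field_derivative:
  "((\<lambda>y. test_fun D j m y t) has_field_derivative
      poly (pderiv (basis_poly D j m)) (x - cell_vel D j * (t - tnew D))) (at x)"
  unfolding test_fun_def by (auto intro!: derivative_eq_intros)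

text \<open>The combination is constant in space, so its derivative vanishes.\<close>

lemma deriv_test_fun_combine:
  assumes "\<And>x. (\<Sum>m\<le>pdeg D. c m * test_fun D j m x t) = 1"
  shows "(\<Sum>m\<le>pdeg D. c m * deriv (\<lambda>y. test_fun D j m y t) x) = 0"
proof -
  have "((\<lambda>y. \<Sum>m\<le>pdeg D. c m * test_fun D j m y t) has_field_derivative
      (\<Sum>m\<le>pdeg D. c m * deriv (\<lambda>y. test_fun D j m y t) x)) (at x)"
    using test_fun_has_field_derivative
    by (intro DERIV_sum DERIV_cmult) (metis DERIV_imp_deriv)
  then show ?thesis
    using assms by (simp add: DERIV_unique[OF _ DERIV_const])
qed

lemma gauss_quad_sum:
  "(\<Sum>m\<in>S. c m * gauss_quad D a b (f m)) = gauss_quad D a b (\<lambda>x. \<Sum>m\<in>S. c m * f m x)"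
  unfolding gauss_quad_def sum_distrib_left
  by (subst sum.swap) (simp add: mult_ac)

text \<open>Quadrature is linear in the integrand, and the combined volume integrand is 0 at every
  node. In the boundary terms the test functions combine to 1, which leaves the bare fluxes.\<close>

lemma spatial_op_combine:
  assumes c: "\<And>x. (\<Sum>m\<le>pdeg D. c m * test_fun D j m x t) = 1"
  shows "(\<Sum>m\<le>pdeg D. c m * spatial_op D U j t m) = iface_flux D U (j - 1) t - iface_flux D U j t"
proof -
  let ?q = "\<lambda>m. gauss_quad D (moving_iface D (j - 1) t) (moving_iface D j t)
    (\<lambda>x. (vel D x t - cell_vel D j) * uh D U j t x * deriv (\<lambda>y. test_fun D j m y t) x)"
  have "(\<Sum>m\<le>pdeg D. c m * spatial_op D U j t m) =
      - iface_flux D U j t * (\<Sum>m\<le>pdeg D. c m * test_fun D j m (moving_iface D j t) t)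
      + iface_flux D U (j - 1) t *
          (\<Sum>m\<le>pdeg D. c m * test_fun D j m (moving_iface D (j - 1) t) t)
      + (\<Sum>m\<le>pdeg D. c m * ?q m)"
    unfolding spatial_op_def sum_distrib_left sum.distrib[symmetric]
    by (intro sum.cong) (auto simp: algebra_simps)
  moreover have "(\<Sum>m\<le>pdeg D. c m * ?q m) = gauss_quad D (moving_iface D (j - 1) t)
      (moving_iface D j t) (\<lambda>x. (vel D x t - cell_vel D j) * uh D U j t x *
        (\<Sum>m\<le>pdeg D. c m * deriv (\<lambda>y. test_fun D j m y t) x))"
    unfolding gauss_quad_sum sum_distrib_left by (simp add: mult_ac)
  ultimately show ?thesis
    by (simp add: c deriv_test_fun_combine[OF c] gauss_quad_def)
qed

subsection \<open>The accumulated numerical flux\<close>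

text \<open>\<open>F l j\<close> is the numerical flux at interface \<open>j\<close> and stage \<open>l\<close>.\<close>

fun stage_flux :: "gel_dg \<Rightarrow> (nat \<Rightarrow> int \<Rightarrow> real) \<Rightarrow> nat \<Rightarrow> int \<Rightarrow> real" where
  "stage_flux D F 0 j = 0"
| "stage_flux D F (Suc i) j =
    (\<Sum>l<Suc i. rk_alpha D (Suc i) l * stage_flux D F l j + rk_beta D (Suc i) l * F l j)"

declare stage_flux.simps(2) [simp del]

text \<open>Periodicity is asked of the stages before \<open>i\<close> only, since the stage
  coefficients are known to be periodic only up to the last stage.\<close>

lemma stage_flux_shift:
  assumes "\<And>l j. l < i \<Longrightarrow> F l (j + p) = F l j"
  shows "stage_flux D F i (j + p) = stage_flux D F i j"
  using assms
proof (induction i rule: less_induct)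
  case (less i)
  show ?case
  proof (cases i)
    case (Suc k)
    show ?thesis
      unfolding Suc stage_flux.simps(2) using less by (intro sum.cong) (auto simp: Suc)
  qed simp
qed

text \<open>Strong induction over the stages: since the weights \<open>rk_alpha D i l\<close> sum to
  1, the initial mass \<open>M 0\<close> is carried through each stage, while the flux differences
  obey the recursion of \<open>stage_flux\<close> at each of the two interfaces.\<close>

lemma stage_mass_update:
  fixes M :: "nat \<Rightarrow> real"
  assumes step: "\<And>i. i \<in> {1..s} \<Longrightarrow>
      M i = (\<Sum>l<i. rk_alpha D i l * M l + rk_beta D i l * \<tau> * (F l (j - 1) - F l j))"
    and one: "\<And>i. i \<in> {1..s} \<Longrightarrow> (\<Sum>l<i. rk_alpha D i l) = 1"
    and "i \<le> s"
  shows "M i = M 0 - \<tau> * (stage_flux D F i j - stage_flux D F i (j - 1))"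
  using \<open>i \<le> s\<close>
proof (induction i rule: less_induct)
  case (less i)
  show ?case
  proof (cases i)
    case (Suc k)
    have i: "i \<in> {1..s}"
      using less.prems Suc by simp
    have "M i = (\<Sum>l<i. rk_alpha D i l * (M 0 - \<tau> * (stage_flux D F l j - stage_flux D F l (j - 1)))
        + rk_beta D i l * \<tau> * (F l (j - 1) - F l j))"
      unfolding step[OF i]
      by (intro sum.cong refl, subst less.IH) (use less.prems in auto)
    also have "\<dots> = (\<Sum>l<i. rk_alpha D i l) * M 0
        - \<tau> * ((\<Sum>l<i. rk_alpha D i l * stage_flux D F l j + rk_beta D i l * F l j)
             - (\<Sum>l<i. rk_alpha D i l * stage_flux D F l (j - 1) + rk_beta D i l * F l (j - 1)))"
      unfolding sum_distrib_right sum_distrib_left sum_subtractf[symmetric]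
      by (intro sum.cong) (auto simp: algebra_simps)
    also have "\<dots> = M 0 - \<tau> * (stage_flux D F i j - stage_flux D F i (j - 1))"
      using one[OF i] by (simp add: Suc stage_flux.simps(2))
    finally show ?thesis .
  qed simp
qed

lemma gel_dg_step_mass:
  assumes mesh: "mesh_ok D" and "basis_ok D" and rk: "ssp_rk_ok D" and v: "v \<in> Vh D"
    and init: "\<And>m. m \<le> pdeg D \<Longrightarrow> mass_mult D j (told D) (U 0 j) m =
      integral (upstream_cell D j) (\<lambda>x. v x * test_fun D j m x (told D))"
    and stage: "\<And>i m. \<lbrakk>i \<in> {1..nstages D}; m \<le> pdeg D\<rbrakk> \<Longrightarrow>
      mass_mult D j (stage_time D i) (U i j) m =
      (\<Sum>l<i. rk_alpha D i l * mass_mult D j (stage_time D l) (U l j) m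
            + rk_beta D i l * dt D * spatial_op D (U l) j (stage_time D l) m)"
    and final: "\<And>x. x \<in> interior (cell D j) \<Longrightarrow> v' x = uh D (U (nstages D)) j (tnew D) x"
  defines "F \<equiv> \<lambda>l j. iface_flux D (U l) j (stage_time D l)"
  shows "integral (cell D j) v' = integral (upstream_cell D j) v
    - dt D * (stage_flux D F (nstages D) j - stage_flux D F (nstages D) (j - 1))"
proof -
  obtain c where "(\<Sum>m\<le>pdeg D. smult (c m) (basis_poly D j m)) = 1"
    using basis_poly_combine_1[OF \<open>basis_ok D\<close>] .
  note c = test_fun_combine_1[OF this]
  \<comment> \<open>\<open>M i\<close> is the mass of stage \<open>i\<close> in the moving cell. As
    \<open>c\<close> is the same at all stages, the stage equations at different times can be
    combined with it.\<close>
  define M where "M = (\<lambda>i. \<Sum>m\<le>pdeg D. c m * mass_mult D j (stage_time D i) (U i j) m)"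
  have M_step: "M i = (\<Sum>l<i. rk_alpha D i l * M l + rk_beta D i l * dt D * (F l (j - 1) - F l j))"
    if "i \<in> {1..nstages D}" for i
  proof -
    have "M i = (\<Sum>m\<le>pdeg D. \<Sum>l<i.
        rk_alpha D i l * (c m * mass_mult D j (stage_time D l) (U l j) m)
        + rk_beta D i l * dt D * (c m * spatial_op D (U l) j (stage_time D l) m))"
      unfolding M_def using stage[OF that]
      by (intro sum.cong) (auto simp: sum_distrib_left algebra_simps)
    also have "\<dots> = (\<Sum>l<i. rk_alpha D i l * M l + rk_beta D i l * dt D *
        (\<Sum>m\<le>pdeg D. c m * spatial_op D (U l) j (stage_time D l) m))"
      by (subst sum.swap) (simp add: M_def sum.distrib sum_distrib_left)
    finally show ?thesis
      by (simp add: spatial_op_combine[OF c] F_def)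
  qed
  have M_eq: "M (nstages D) =
      M 0 - dt D * (stage_flux D F (nstages D) j - stage_flux D F (nstages D) (j - 1))"
    using M_step rk by (intro stage_mass_update[where s = "nstages D"]) (auto simp: ssp_rk_ok_def)
  have times: "stage_time D 0 = told D" "stage_time D (nstages D) = tnew D"
    using rk unfolding ssp_rk_ok_def stage_time_def dt_def by auto
  have "M 0 = (\<Sum>m\<le>pdeg D. c m * integral (upstream_cell D j) (\<lambda>x. v x * test_fun D j m x (told D)))"
    unfolding M_def times by (simp add: init)
  also have "\<dots> = integral (upstream_cell D j) v"
  proof (rule integral_combine_test_fun[OF c])
    show "(\<lambda>x. v x * test_fun D j m x (told D)) integrable_on upstream_cell D j" for m
      unfolding upstream_cell_def moving_cell_def
      by (rule Vh_mult_continuous_integrable[OF mesh v continuous_on_test_fun])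
  qed
  finally have M_0: "M 0 = integral (upstream_cell D j) v" .
  have "M (nstages D) = integral (moving_cell D j (tnew D)) (uh D (U (nstages D)) j (tnew D))"
    unfolding M_def times by (rule mass_mult_combine[OF c])
  \<comment> \<open>The moving interfaces arrive at the mesh interfaces at the new time.\<close>
  also have "moving_cell D j (tnew D) = cell D j"
    by (simp add: moving_cell_def cell_def moving_iface_def)
  also have "integral (cell D j) (uh D (U (nstages D)) j (tnew D)) = integral (cell D j) v'"
    \<comment> \<open>The scheme prescribes \<open>v'\<close> only inside the cell; the two end
      points are negligible.\<close>
    by (rule integral_spike[where S = "{iface D (j - 1), iface D j}"])
      (auto simp: cell_def intro!: final)
  finally show ?thesis
    using M_eq M_0 by simp
qed

theorem theorem2p1:
  fixes D :: gel_dg and v v' :: "real \<Rightarrow> real"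
  assumes "mesh_ok D" and "vel_ok D" and "basis_ok D" and "flux_ok D"
    and "is_gauss_rule (pdeg D + 1) (gnode D) (gweight D)"
    and "ssp_rk_ok D"
    and "v \<in> Vh D" and "v' \<in> Vh D"
    and "gel_dg_step D v v'"
  shows "locally_mass_conservative D v v' \<and>
    (\<Sum>j=1..int (ncells D). integral (cell D j) v') =
    (\<Sum>j=1..int (ncells D). integral (cell D j) v)"
proof -
  obtain U where U:
    "\<forall>i\<le>nstages D. \<forall>j. \<forall>l\<le>pdeg D. U i (j + int (ncells D)) l = U i j l"
    "\<forall>j. \<forall>m\<le>pdeg D. mass_mult D j (told D) (U 0 j) m =
      integral (upstream_cell D j) (\<lambda>x. v x * test_fun D j m x (told D))"
    "\<forall>i\<in>{1..nstages D}. \<forall>j. \<forall>m\<le>pdeg D. mass_mult D j (stage_time D i) (U i j) m =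
      (\<Sum>l<i. rk_alpha D i l * mass_mult D j (stage_time D l) (U l j) m
            + rk_beta D i l * dt D * spatial_op D (U l) j (stage_time D l) m)"
    "\<forall>j. \<forall>x\<in>interior (cell D j). v' x = uh D (U (nstages D)) j (tnew D) x"
    using \<open>gel_dg_step D v v'\<close> unfolding gel_dg_step_def by (elim exE conjE) (rule that)
  \<comment> \<open>\<open>H\<close> is built from the interface fluxes alone, not from the
    coefficients chosen in a cell, so both neighbours of an interface see the same number.\<close>
  define H where
    "H = stage_flux D (\<lambda>l j. iface_flux D (U l) j (stage_time D l)) (nstages D)"
  have H_shift: "H (j + int (ncells D)) = H j" for j
    unfolding H_def using U(1)
    by (intro stage_flux_shift iface_flux_shift assms) auto
  have mass: "integral (cell D j) v' = integral (upstream_cell D j) v - dt D * (H j - H (j - 1))"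
    for j
    unfolding H_def by (intro gel_dg_step_mass U[rule_format] assms)
  have int: "v integrable_on {a..b}" for a b
    using Vh_mult_continuous_integrable[of D v "\<lambda>_. 1"] assms by simp
  have v_shift: "v (x + period D) = v x" for x
    using \<open>v \<in> Vh D\<close> unfolding Vh_def by blast
  have P: "0 \<le> period D"
    using period_pos[OF \<open>mesh_ok D\<close>] by simp
  have telescope: "(\<Sum>j=1..int n. H j - H (j - 1)) = H (int n) - H 0" for n
  proof (induction n)
    case (Suc n)
    have "{1..int (Suc n)} = insert (1 + int n) {1..int n}"
      by auto
    with Suc show ?case
      by simp
  qed simp
  have "(\<Sum>j=1..int (ncells D). integral (cell D j) v') =
      (\<Sum>j=1..int (ncells D). integral (upstream_cell D j) v)
      - dt D * (\<Sum>j=1..int (ncells D). H j - H (j - 1))"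
    unfolding mass sum_subtractf sum_distrib_left[symmetric] ..
  \<comment> \<open>The flux sum telescopes to \<open>H (int (ncells D)) - H 0\<close>, which is 0
    by periodicity.\<close>
  also have "\<dots> = (\<Sum>j=1..int (ncells D). integral (upstream_cell D j) v)"
    using H_shift[of 0] by (simp add: telescope)
  also have "\<dots> = integral {moving_iface D 0 (told D)..moving_iface D (int (ncells D)) (told D)} v"
    unfolding upstream_cell_def moving_cell_def
    using \<open>mesh_ok D\<close> int unfolding mesh_ok_def
    by (intro sum_integral_consecutive) (auto intro: less_imp_le)
  \<comment> \<open>The first and last traced-back interfaces are one period apart, because their
    velocities agree.\<close>
  also have "\<dots> = integral {iface D 0..iface D (int (ncells D))} v"
    using integral_over_period[OF v_shift P int, of "moving_iface D 0 (told D)" "iface D 0"]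
      moving_iface_shift[OF assms(1,2), of 0 "told D"]
    by (simp add: period_def)
  also have "\<dots> = (\<Sum>j=1..int (ncells D). integral (cell D j) v)"
    unfolding cell_def using \<open>mesh_ok D\<close> int unfolding mesh_ok_def
    by (intro sum_integral_consecutive[symmetric]) (auto simp: strict_mono_less_eq)
  finally show ?thesis
    unfolding locally_mass_conservative_def using H_shift mass by blast
qed

end
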